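(* Let the labels $T^{s}_{r,d,X}$ be as defined in the context, computed from the all-one $n$-grid with $n$ sufficiently large. For each even integer $e \ge 0$ there exist rational functions $G_e$ and $G_{e+1}$, each in $\frac{e}{2}+1$ variables and depending only on $e$ (not on $k$ or $n$), such that for every integer $k \ge 0$: $$T^{\frac{e}{2}+2+k}_{e+3+2k,\,2+k,\,L} = G_{e}\Big(T^{1+k}_{1+2k,1+k,L},\ T^{2+k}_{3+2k,1+k,L},\ \dots,\ T^{\frac{e}{2}+1+k}_{e+1+2k,1+k,L}\Big),$$ and $$T^{\frac{e}{2}+2+k}_{e+3+2k,\,1+k,\,R} = G_{e+1}\Big(T^{1+k}_{1+2k,1+k,L},\ T^{2+k}_{3+2k,1+k,L},\ \dots,\ T^{\frac{e}{2}+1+k}_{e+1+2k,1+k,L}\Big).$$ (The arguments are $T^{j+k}_{2j-1+2k,\,1+k,\,L}$ for $j=1,\dots,\frac{e}{2}+1$.)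
   Context: The triangular $m$-grid consists of $m$ rows of upright unit triangles in the triangular lattice, row $r$ ($1\le r\le m$, counted top to bottom) containing $r$ upright triangles $T_{r,d}$, $1\le d\le r$, numbered left to right ($d$ is called the diagonal). Every edge of the grid is the left ($L$), right ($R$) or base ($B$) edge of exactly one upright triangle. Each edge carries a positive real label (a resistance). The all-one $n$-grid has every label equal to $1$. Reduction of a labeled $m$-grid ($m\ge2$) to a labeled $(m-1)$-grid: (1) replace each upright triangle with edge labels $a,b,c$ by a star with a new center vertex, the star edge to a vertex $v$ of the triangle getting label (product of the two triangle labels at $v$)$/(a+b+c)$ (the $\Delta$-$Y$ transformation); (2) delete the three pendant star edges at the three corner vertices of the grid; (3) each non-corner boundary vertex of the original grid now has degree 2: replace its two edges by one edge whose label is the sum of the two labels (series); (4) each interior vertex of the original grid now is the center of a claw whose three edges go to star centers with labels $x_1,x_2,x_3$: replace it by a triangle on those three star centers, the edge between the leaves of $x_i,x_j$ getting label $(x_1x_2+x_2x_3+x_3x_1)/x_k$ where $\{i,j,k\}=\{1,2,3\}$ ($Y$-$\Delta$). The result is a labeled $(m-1)$-grid whose upright triangle $T_{r,d}$ has as vertices the star centers of the parent triangles $T_{r,d}$ (top), $T_{r+1,d}$ (bottom left), $T_{r+1,d+1}$ (bottom right). $T^{s}_{r,d,X}$ ($X\in\{L,R,B\}$) denotes the label of edge $X$ of triangle $T_{r,d}$ in the $(n-s)$-grid obtained from the all-one $n$-grid by $s$ successive reductions. *)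

theory Defs
  imports
    Complex_Main
    "HOL-Library.Poly_Mapping"
    "HOL-Computational_Algebra.Fraction_Field"
begin

datatype edge = Edge_L | Edge_R | Edge_B

datatype corner = Top | Bot_L | Bot_R

(* A labelled m-grid: the label of edge X of the upright triangle T_{r,d} is g r d X.
   Only the values with 1 <= d <= r <= m are meaningful. *)
type_synonym grid = "nat \<Rightarrow> nat \<Rightarrow> edge \<Rightarrow> real"

(* Delta-Y: the label of the star edge from the new centre of T_{r,d} to the corner v,
   i.e. the product of the two triangle labels at v over the sum of all three. *)
fun star :: "grid \<Rightarrow> nat \<Rightarrow> nat \<Rightarrow> corner \<Rightarrow> real" where
  "star g r d Top = g r d Edge_L * g r d Edge_R / (g r d Edge_L + g r d Edge_R + g r d Edge_B)"
| "star g r d Bot_L = g r d Edge_L * g r d Edge_B / (g r d Edge_L + g r d Edge_R + g r d Edge_B)"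
| "star g r d Bot_R = g r d Edge_R * g r d Edge_B / (g r d Edge_L + g r d Edge_R + g r d Edge_B)"

(* Y-Delta: the label of the triangle edge between the leaves of x and y,
   where z is the third edge of the claw. *)
definition claw_edge :: "real \<Rightarrow> real \<Rightarrow> real \<Rightarrow> real" where
  "claw_edge x y z = (x * y + y * z + z * x) / z"

(* Reduction of an m-grid to an (m-1)-grid. Each new edge arises at a non-corner vertex v of
   the m-grid, and joins the star centres of two of the parent triangles having v as a corner:
     L joins the centres of T_{r,d} and T_{r+1,d}, with v the bottom left corner of T_{r,d};
     R joins the centres of T_{r,d} and T_{r+1,d+1}, with v the bottom right corner of T_{r,d};
     B joins the centres of T_{r+1,d} and T_{r+1,d+1}, with v the bottom right corner of T_{r+1,d}.
   The conditions d = 1, d = r and r + 1 = m say that v is on the boundary of the grid (series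
   case); otherwise v is interior, and a third parent triangle has v as a corner. The star
   edges at the three corner vertices of the grid are not used. *)
fun reduce :: "nat \<Rightarrow> grid \<Rightarrow> grid" where
  "reduce m g r d Edge_L =
     (if d = 1 then star g r d Bot_L + star g (r + 1) d Top
      else claw_edge (star g r d Bot_L) (star g (r + 1) d Top) (star g r (d - 1) Bot_R))"
| "reduce m g r d Edge_R =
     (if d = r then star g r d Bot_R + star g (r + 1) (d + 1) Top
      else claw_edge (star g r d Bot_R) (star g (r + 1) (d + 1) Top) (star g r (d + 1) Bot_L))"
| "reduce m g r d Edge_B =
     (if r + 1 = m then star g (r + 1) d Bot_R + star g (r + 1) (d + 1) Bot_L
      else claw_edge (star g (r + 1) d Bot_R) (star g (r + 1) (d + 1) Bot_L)
             (star g (r + 2) (d + 1) Top))"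

primrec reduced_grid :: "nat \<Rightarrow> nat \<Rightarrow> grid" where
  "reduced_grid n 0 = (\<lambda>r d X. 1)"
| "reduced_grid n (Suc s) = reduce (n - s) (reduced_grid n s)"

(* T^s_{r,d,X}, computed from the all-one n-grid; meaningful for 1 <= d <= r <= n - s. *)
definition tri_label :: "nat \<Rightarrow> nat \<Rightarrow> nat \<Rightarrow> nat \<Rightarrow> edge \<Rightarrow> real" where
  "tri_label n s r d X = reduced_grid n s r d X"

(* Real polynomials in indeterminates indexed by nat: a monomial is its finitely supported
   exponent vector, and a polynomial maps monomials to coefficients. *)
type_synonym rpoly = "(nat \<Rightarrow>\<^sub>0 nat) \<Rightarrow>\<^sub>0 real"

(* The polynomials in the N indeterminates with indices 1, ..., N. *)
definition rpolys :: "nat \<Rightarrow> rpoly set" where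
  "rpolys N = {p. \<forall>t \<in> Poly_Mapping.keys p. Poly_Mapping.keys t \<subseteq> {1..N}}"

definition rpoly_eval :: "rpoly \<Rightarrow> (nat \<Rightarrow> real) \<Rightarrow> real" where
  "rpoly_eval p x =
     (\<Sum>t\<in>Poly_Mapping.keys p. Poly_Mapping.lookup p t *
        (\<Prod>i\<in>Poly_Mapping.keys t. x i ^ Poly_Mapping.lookup t i))"

(* The field of rational functions in N variables, inside the field of fractions of rpoly. *)
definition ratfuns :: "nat \<Rightarrow> rpoly fract set" where
  "ratfuns N = {Fract p q | p q. p \<in> rpolys N \<and> q \<in> rpolys N \<and> q \<noteq> 0}"

(* "G is defined at (x 1, ..., x N) and takes the value v there": some representation of G
   has a denominator that does not vanish at the point. *)
definition ratfun_value :: "nat \<Rightarrow> rpoly fract \<Rightarrow> (nat \<Rightarrow> real) \<Rightarrow> real \<Rightarrow> bool" where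
  "ratfun_value N G x v \<longleftrightarrow>
     (\<exists>p \<in> rpolys N. \<exists>q \<in> rpolys N. G = Fract p q \<and> rpoly_eval q x \<noteq> 0 \<and>
        v = rpoly_eval p x / rpoly_eval q x)"

end

theory Submission
  imports Defs
begin

text \<open>Away from the base and the right side, the labels of the reduced grids do not depend on the
  row, and the influence of the left side advances by one diagonal per reduction. The labels
  \<open>R\<close> and \<open>B\<close> of diagonal \<open>d\<close> and the label \<open>L\<close> of diagonal \<open>d + 1\<close>
  form the triangle replacing one claw, so they are subtraction-free rational functions of the
  previous labels of diagonals \<open>d\<close> and \<open>d + 1\<close>. Counting reductions from the arrival
  of the front, induction expresses all of them by the labels \<open>L\<close> of diagonal \<open>d\<close>,
  uniformly in \<open>d\<close>. Subtraction-free functions have no poles at positive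
  arguments, so no denominator vanishes.\<close>

section \<open>Evaluation of polynomials\<close>

definition monom_eval :: "(nat \<Rightarrow>\<^sub>0 nat) \<Rightarrow> (nat \<Rightarrow> real) \<Rightarrow> real" where
  "monom_eval t x = (\<Prod>i\<in>Poly_Mapping.keys t. x i ^ Poly_Mapping.lookup t i)"

text \<open>Enlarging the support only inserts zeroth powers, so monomials with different supports
  can be compared over one index set.\<close>

lemma monom_eval_superset:
  assumes "finite A" "Poly_Mapping.keys t \<subseteq> A"
  shows "monom_eval t x = (\<Prod>i\<in>A. x i ^ Poly_Mapping.lookup t i)"
  unfolding monom_eval_def using assms
  by (intro prod.mono_neutral_left) (auto simp: in_keys_iff)

lemma monom_eval_plus: "monom_eval (s + t) x = monom_eval s x * monom_eval t x"
proof -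
  let ?A = "Poly_Mapping.keys s \<union> Poly_Mapping.keys t"
  have "Poly_Mapping.keys (s + t) \<subseteq> ?A"
    by (rule Poly_Mapping.keys_add)
  then show ?thesis
    by (simp add: monom_eval_superset[of ?A] lookup_add power_add prod.distrib)
qed

lemma rpoly_eval_superset:
  assumes "finite A" "Poly_Mapping.keys p \<subseteq> A"
  shows "rpoly_eval p x = (\<Sum>t\<in>A. Poly_Mapping.lookup p t * monom_eval t x)"
  unfolding rpoly_eval_def monom_eval_def[symmetric] using assms
  by (intro sum.mono_neutral_left) (auto simp: in_keys_iff)

lemma rpoly_eval_plus: "rpoly_eval (p + q) x = rpoly_eval p x + rpoly_eval q x"
proof -
  let ?A = "Poly_Mapping.keys p \<union> Poly_Mapping.keys q"
  have "Poly_Mapping.keys (p + q) \<subseteq> ?A"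
    by (rule Poly_Mapping.keys_add)
  then show ?thesis
    by (simp add: rpoly_eval_superset[of ?A] lookup_add distrib_right sum.distrib)
qed

lemma rpoly_eval_single: "rpoly_eval (Poly_Mapping.single t c) x = c * monom_eval t x"
  by (subst rpoly_eval_superset[of "{t}"]) auto

lemma rpoly_eval_zero [simp]: "rpoly_eval 0 x = 0"
  by (simp add: rpoly_eval_def)

lemma rpoly_eval_one [simp]: "rpoly_eval 1 x = 1"
  by (simp add: rpoly_eval_single monom_eval_def flip: single_one)

lemma poly_mapping_induct_single:
  fixes p :: "'a \<Rightarrow>\<^sub>0 'b::monoid_add"
  assumes "P 0" "\<And>t c p. P p \<Longrightarrow> P (Poly_Mapping.single t c + p)"
  shows "P p"
proof (induction p rule: Poly_Mapping.update_induct)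
  case const
  show ?case by fact
next
  case (update p t c)
  have "Poly_Mapping.update t c p = Poly_Mapping.single t c + p"
    using update.hyps(1)
    by (intro poly_mapping_eqI)
      (auto simp: lookup_add Poly_Mapping.lookup_update lookup_single in_keys_iff when_def)
  then show ?case using assms(2) update by simp
qed

text \<open>Both sides are additive in each factor, so comparing monomials suffices:
  \<open>p\<close> is first held to one monomial while \<open>q\<close> grows, then \<open>p\<close>
  grows.\<close>

lemma rpoly_eval_times: "rpoly_eval (p * q) x = rpoly_eval p x * rpoly_eval q x"
proof -
  have single: "rpoly_eval (Poly_Mapping.single s c * q) x =
      rpoly_eval (Poly_Mapping.single s c) x * rpoly_eval q x" for s c
    by (induction q rule: poly_mapping_induct_single)
      (simp_all add: mult_single rpoly_eval_single monom_eval_plus rpoly_eval_plus distrib_left)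
  show ?thesis
    by (induction p rule: poly_mapping_induct_single)
      (simp_all add: single distrib_right rpoly_eval_plus)
qed

lemma rpoly_eval_cong:
  assumes "p \<in> rpolys N" "\<And>i. i \<in> {1..N} \<Longrightarrow> x i = y i"
  shows "rpoly_eval p x = rpoly_eval p y"
proof -
  have "x i = y i" if "t \<in> Poly_Mapping.keys p" "i \<in> Poly_Mapping.keys t" for t i
    using that assms unfolding rpolys_def by blast
  then show ?thesis
    unfolding rpoly_eval_def by (intro sum.cong prod.cong arg_cong2[where f = "(*)"] refl) simp
qed

lemma rpolys_one: "1 \<in> rpolys N"
  by (simp add: rpolys_def)

lemma rpolys_plus: "p \<in> rpolys N \<Longrightarrow> q \<in> rpolys N \<Longrightarrow> p + q \<in> rpolys N"
  using Poly_Mapping.keys_add[of p q] unfolding rpolys_def by blast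

lemma rpolys_times:
  assumes "p \<in> rpolys N" "q \<in> rpolys N"
  shows "p * q \<in> rpolys N"
  unfolding rpolys_def
proof (intro CollectI ballI)
  fix t assume "t \<in> Poly_Mapping.keys (p * q)"
  then obtain a b where "t = a + b" "a \<in> Poly_Mapping.keys p" "b \<in> Poly_Mapping.keys q"
    using Poly_Mapping.keys_mult[of p q] by blast
  then show "Poly_Mapping.keys t \<subseteq> {1..N}"
    using assms Poly_Mapping.keys_add[of a b] unfolding rpolys_def by blast
qed

section \<open>Subtraction-free functions\<close>

text \<open>The members are functions of a parameter instead of formal expressions: one derivation
  serves all parameter values, which gives the uniformity in \<open>k\<close>.\<close>

inductive_set subtraction_free :: "('a \<Rightarrow> real) set \<Rightarrow> ('a \<Rightarrow> real) set"
  for S :: "('a \<Rightarrow> real) set" where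
  base: "f \<in> S \<Longrightarrow> f \<in> subtraction_free S"
| one: "(\<lambda>_. 1) \<in> subtraction_free S"
| add: "f \<in> subtraction_free S \<Longrightarrow> g \<in> subtraction_free S \<Longrightarrow>
    (\<lambda>k. f k + g k) \<in> subtraction_free S"
| mult: "f \<in> subtraction_free S \<Longrightarrow> g \<in> subtraction_free S \<Longrightarrow>
    (\<lambda>k. f k * g k) \<in> subtraction_free S"
| divide: "f \<in> subtraction_free S \<Longrightarrow> g \<in> subtraction_free S \<Longrightarrow>
    (\<lambda>k. f k / g k) \<in> subtraction_free S"

text \<open>Every closure operation is pointwise, so it commutes with a reparametrisation
  \<open>h\<close>; only the generators need to be re-expressed.\<close>

lemma subtraction_free_compose:
  assumes "f \<in> subtraction_free S" "\<And>g. g \<in> S \<Longrightarrow> (\<lambda>k. g (h k)) \<in> subtraction_free S'"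
  shows "(\<lambda>k. f (h k)) \<in> subtraction_free S'"
  using assms(1) by induction (auto intro: subtraction_free.intros assms(2))

lemma subtraction_free_mono:
  "f \<in> subtraction_free S \<Longrightarrow> S \<subseteq> S' \<Longrightarrow> f \<in> subtraction_free S'"
  using subtraction_free_compose[of f S "\<lambda>k. k" S'] by (auto intro: subtraction_free.base)

text \<open>The pair \<open>p\<close>, \<open>q\<close> is chosen before \<open>k\<close>.
  Positivity at every positive point is carried through the induction, so that no denominator
  vanishes.\<close>

lemma subtraction_free_rational:
  fixes x :: "'a \<Rightarrow> nat \<Rightarrow> real"
  assumes "f \<in> subtraction_free ((\<lambda>j k. x k j) ` {1..N})"
    and pos: "\<And>k j. x k j > 0"
  shows "\<exists>p\<in>rpolys N. \<exists>q\<in>rpolys N.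
    (\<forall>y. (\<forall>j. y j > 0) \<longrightarrow> rpoly_eval p y > 0 \<and> rpoly_eval q y > 0) \<and>
    (\<forall>k. f k = rpoly_eval p (x k) / rpoly_eval q (x k))"
proof -
  define rep where "rep f p q \<longleftrightarrow> p \<in> rpolys N \<and> q \<in> rpolys N \<and>
    (\<forall>y. (\<forall>j. y j > 0) \<longrightarrow> rpoly_eval p y > 0 \<and> rpoly_eval q y > 0) \<and>
    (\<forall>k. f k = rpoly_eval p (x k) / rpoly_eval q (x k))" for f p q
  have rep_pos: "rpoly_eval p y > 0 \<and> rpoly_eval q y > 0" if "rep f p q" "\<forall>j. y j > 0" for f p q y
    using that unfolding rep_def by blast
  have rep_val: "f k = rpoly_eval p (x k) / rpoly_eval q (x k)" if "rep f p q" for f p q k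
    using that unfolding rep_def by blast
  have "\<exists>p q. rep f p q"
    using assms(1)
  proof induction
    case (base f)
    then obtain j where j: "j \<in> {1..N}" "f = (\<lambda>k. x k j)" by auto
    then have "rep f (Poly_Mapping.single (Poly_Mapping.single j 1) 1) 1"
      by (simp add: rep_def rpolys_def rpoly_eval_single monom_eval_def)
    then show ?case by blast
  next
    case one
    have "rep (\<lambda>_. 1) 1 1" by (simp add: rep_def rpolys_one)
    then show ?case by blast
  next
    case (add f g)
    then obtain p q p' q' where pq: "rep f p q" "rep g p' q'" by blast
    have "rep (\<lambda>k. f k + g k) (p * q' + p' * q) (q * q')"
      unfolding rep_def
    proof (intro conjI allI impI)
      show "p * q' + p' * q \<in> rpolys N" "q * q' \<in> rpolys N"
        using pq unfolding rep_def by (blast intro: rpolys_plus rpolys_times)+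
    next
      fix y :: "nat \<Rightarrow> real" assume y: "\<forall>j. y j > 0"
      show "rpoly_eval (p * q' + p' * q) y > 0" "rpoly_eval (q * q') y > 0"
        using rep_pos[OF pq(1) y] rep_pos[OF pq(2) y]
        by (simp_all add: rpoly_eval_plus rpoly_eval_times add_pos_pos)
    next
      fix k
      show "f k + g k = rpoly_eval (p * q' + p' * q) (x k) / rpoly_eval (q * q') (x k)"
        using rep_pos[OF pq(1), of "x k"] rep_pos[OF pq(2), of "x k"] pos
        by (simp add: rep_val[OF pq(1)] rep_val[OF pq(2)] rpoly_eval_plus rpoly_eval_times
            add_frac_eq)
    qed
    then show ?case by blast
  next
    case (mult f g)
    then obtain p q p' q' where pq: "rep f p q" "rep g p' q'" by blast
    have "rep (\<lambda>k. f k * g k) (p * p') (q * q')"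
      unfolding rep_def
    proof (intro conjI allI impI)
      show "p * p' \<in> rpolys N" "q * q' \<in> rpolys N"
        using pq unfolding rep_def by (blast intro: rpolys_plus rpolys_times)+
    next
      fix y :: "nat \<Rightarrow> real" assume y: "\<forall>j. y j > 0"
      show "rpoly_eval (p * p') y > 0" "rpoly_eval (q * q') y > 0"
        using rep_pos[OF pq(1) y] rep_pos[OF pq(2) y]
        by (simp_all add: rpoly_eval_plus rpoly_eval_times add_pos_pos)
    next
      fix k
      show "f k * g k = rpoly_eval (p * p') (x k) / rpoly_eval (q * q') (x k)"
        by (simp add: rep_val[OF pq(1)] rep_val[OF pq(2)] rpoly_eval_times)
    qed
    then show ?case by blast
  next
    case (divide f g)
    then obtain p q p' q' where pq: "rep f p q" "rep g p' q'" by blast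
    \<comment> \<open>The numerator \<open>p'\<close> of the divisor enters the denominator; hence
      \<open>rep\<close> also demands positive numerators.\<close>
    have "rep (\<lambda>k. f k / g k) (p * q') (q * p')"
      unfolding rep_def
    proof (intro conjI allI impI)
      show "p * q' \<in> rpolys N" "q * p' \<in> rpolys N"
        using pq unfolding rep_def by (blast intro: rpolys_plus rpolys_times)+
    next
      fix y :: "nat \<Rightarrow> real" assume y: "\<forall>j. y j > 0"
      show "rpoly_eval (p * q') y > 0" "rpoly_eval (q * p') y > 0"
        using rep_pos[OF pq(1) y] rep_pos[OF pq(2) y]
        by (simp_all add: rpoly_eval_plus rpoly_eval_times add_pos_pos)
    next
      fix k
      show "f k / g k = rpoly_eval (p * q') (x k) / rpoly_eval (q * p') (x k)"
        by (simp add: rep_val[OF pq(1)] rep_val[OF pq(2)] rpoly_eval_times)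
    qed
    then show ?case by blast
  qed
  then show ?thesis unfolding rep_def by blast
qed

text \<open>The point \<open>y\<close> is tied to \<open>x k\<close> only at the indices 1 to
  \<open>N\<close>, since labels of a finite grid agree with their row-independent values only in a
  limited range.\<close>

lemma subtraction_free_ratfun:
  fixes x :: "'a \<Rightarrow> nat \<Rightarrow> real"
  assumes "f \<in> subtraction_free ((\<lambda>j k. x k j) ` {1..N})"
    and "\<And>k j. x k j > 0"
  shows "\<exists>G\<in>ratfuns N. \<forall>k y. (\<forall>j\<in>{1..N}. y j = x k j) \<longrightarrow> ratfun_value N G y (f k)"
proof -
  obtain p q where mem: "p \<in> rpolys N" "q \<in> rpolys N"
    and pos: "\<And>y. (\<forall>j. y j > 0) \<Longrightarrow> rpoly_eval q y > 0"
    and val: "\<And>k. f k = rpoly_eval p (x k) / rpoly_eval q (x k)"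
    using subtraction_free_rational[OF assms] by blast
  have "q \<noteq> 0" using pos[of "\<lambda>_. 1"] by auto
  then have "Fract p q \<in> ratfuns N" using mem by (auto simp: ratfuns_def)
  moreover have "ratfun_value N (Fract p q) y (f k)" if "\<forall>j\<in>{1..N}. y j = x k j" for k y
  proof -
    have "rpoly_eval p y = rpoly_eval p (x k)" "rpoly_eval q y = rpoly_eval q (x k)"
      using that mem by (auto intro: rpoly_eval_cong)
    moreover have "rpoly_eval q (x k) \<noteq> 0" using pos assms(2) less_irrefl by metis
    ultimately show ?thesis unfolding ratfun_value_def using mem val by metis
  qed
  ultimately show ?thesis by blast
qed

section \<open>The row-independent part of the reduced grids\<close>

text \<open>The row \<open>d + 1\<close> and the grid size \<open>0\<close> make \<open>reduce\<close> avoid the series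
  cases of the right side and of the base.\<close>
primrec strip :: "nat \<Rightarrow> nat \<Rightarrow> edge \<Rightarrow> real" where
  "strip 0 = (\<lambda>d X. 1)"
| "strip (Suc s) = (\<lambda>d. reduce 0 (\<lambda>r. strip s) (d + 1) d)"

declare strip.simps(2) [simp del]

text \<open>Row \<open>0\<close> is arbitrary, as the grid is constant along rows.\<close>

definition strip_star :: "nat \<Rightarrow> nat \<Rightarrow> corner \<Rightarrow> real" where
  "strip_star s d = star (\<lambda>r. strip s) 0 d"

lemma star_cong: "(\<And>X. g r d X = g' r' d X) \<Longrightarrow> star g r d v = star g' r' d v"
  by (cases v) simp_all

lemma star_strip: "star (\<lambda>r. strip s) r d v = strip_star s d v"
  unfolding strip_star_def by (rule star_cong) simp

lemma strip_Suc:
  "strip (Suc s) d Edge_L =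
    (if d = 1 then strip_star s d Bot_L + strip_star s d Top
     else claw_edge (strip_star s d Bot_L) (strip_star s d Top) (strip_star s (d - 1) Bot_R))"
  "strip (Suc s) d Edge_R =
    claw_edge (strip_star s d Bot_R) (strip_star s (d + 1) Top) (strip_star s (d + 1) Bot_L)"
  "strip (Suc s) d Edge_B =
    claw_edge (strip_star s d Bot_R) (strip_star s (d + 1) Bot_L) (strip_star s (d + 1) Top)"
  by (simp_all add: strip.simps(2) star_strip del: star.simps)

lemma star_pos: "(\<And>X. g r d X > 0) \<Longrightarrow> star g r d v > 0"
  by (cases v) (simp_all add: add_pos_pos)

lemma claw_edge_pos: "x > 0 \<Longrightarrow> y > 0 \<Longrightarrow> z > 0 \<Longrightarrow> claw_edge x y z > 0"
  by (simp add: claw_edge_def add_pos_pos)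

lemma strip_pos: "strip s d X > 0"
proof (induction s arbitrary: d X)
  case (Suc s)
  then show ?case
    by (cases X)
      (simp_all add: strip_Suc strip_star_def add_pos_pos star_pos claw_edge_pos del: star.simps)
qed simp

text \<open>All-one labels are reproduced: the star edges are 1/3, and three such edges form a claw
  giving 1 again. \<open>R\<close> and \<open>B\<close> stay 1 for one reduction longer than
  \<open>L\<close>, whose claw reaches back to diagonal \<open>d - 1\<close>.\<close>

lemma strip_beyond_front:
  "s < d \<Longrightarrow> strip s d Edge_L = 1"
  "s \<le> d \<Longrightarrow> strip s d Edge_R = 1"
  "s \<le> d \<Longrightarrow> strip s d Edge_B = 1"
proof (induction s arbitrary: d)
  case (Suc s)
  {
    case 1
    then show ?case using Suc.IH[of d] Suc.IH[of "d - 1"] by (simp add: strip_Suc strip_star_def claw_edge_def)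
  next
    case 2
    then show ?case using Suc.IH[of d] Suc.IH[of "d + 1"] by (simp add: strip_Suc strip_star_def claw_edge_def)
  next
    case 3
    then show ?case using Suc.IH[of d] Suc.IH[of "d + 1"] by (simp add: strip_Suc strip_star_def claw_edge_def)
  }
qed simp_all

text \<open>Per reduction the base rises by one row and its influence by one more, hence
  \<open>2 * s\<close>. The right side gains one diagonal. The claw of \<open>L\<close> avoids
  diagonal \<open>d + 1\<close>, so \<open>L\<close> has one row more to spare; the argument with
  \<open>j = 1\<close> attains this bound.\<close>

lemma tri_label_eq_strip:
  assumes "r + 2 * s \<le> n" "1 \<le> d"
  shows "d + s \<le> r + 1 \<Longrightarrow> tri_label n s r d Edge_L = strip s d Edge_L"
    and "d + s \<le> r \<Longrightarrow> tri_label n s r d Edge_R = strip s d Edge_R"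
    and "d + s \<le> r \<Longrightarrow> tri_label n s r d Edge_B = strip s d Edge_B"
  using assms
proof (induction s arbitrary: r d)
  case (Suc s)
  let ?g = "reduced_grid n s"
  have star: "star ?g r' d' v = strip_star s d' v"
    if "d' + s \<le> r'" "r' + 2 * s \<le> n" "1 \<le> d'" for r' d' v
    unfolding strip_star_def
  proof (rule star_cong)
    fix X show "?g r' d' X = strip s d' X"
      using Suc.IH[of d' r'] that by (cases X) (simp_all add: tri_label_def)
  qed
  {
    case 1
    then show ?case
      by (simp add: tri_label_def strip_Suc star del: star.simps)
  next
    case 2
    then show ?case
      by (simp add: tri_label_def strip_Suc star del: star.simps)
  next
    case 3
    then have "r + 1 < n - s" by simp
    then have "r + 1 \<noteq> n - s" by (rule less_imp_neq)
    moreover have "star ?g (r + 1) d Bot_R = strip_star s d Bot_R"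
      "star ?g (r + 1) (d + 1) Bot_L = strip_star s (d + 1) Bot_L"
      "star ?g (r + 2) (d + 1) Top = strip_star s (d + 1) Top"
      using 3 by (simp_all add: star del: star.simps)
    ultimately show ?case
      by (simp only: tri_label_def strip_Suc reduced_grid.simps reduce.simps if_False)
  }
qed (simp_all add: tri_label_def)

section \<open>Dependence of a diagonal on its predecessor\<close>

text \<open>The arguments of the rational functions, as functions of \<open>k\<close>. An element of
  \<open>subtraction_free (front_labels N)\<close> is one rational expression in them valid for all \<open>k\<close>, and
  composing it with \<open>k \<mapsto> k + 1\<close> passes to the next diagonal.\<close>
definition front_labels :: "nat \<Rightarrow> (nat \<Rightarrow> real) set" where
  "front_labels N = (\<lambda>j k. strip (j + k) (1 + k) Edge_L) ` {1..N}"

lemma front_labels_mono: "M \<le> N \<Longrightarrow> front_labels M \<subseteq> front_labels N"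
  by (auto simp: front_labels_def)

lemma star_subtraction_free:
  assumes "\<And>X. (\<lambda>k. g k (r k) (d k) X) \<in> subtraction_free S"
  shows "(\<lambda>k. star (g k) (r k) (d k) v) \<in> subtraction_free S"
  by (cases v)
    (simp_all add: assms subtraction_free.add subtraction_free.mult subtraction_free.divide)

lemma claw_edge_subtraction_free:
  assumes "f \<in> subtraction_free S" "g \<in> subtraction_free S" "h \<in> subtraction_free S"
  shows "(\<lambda>k. claw_edge (f k) (g k) (h k)) \<in> subtraction_free S"
  unfolding claw_edge_def
  by (intro subtraction_free.add subtraction_free.mult subtraction_free.divide assms)

text \<open>Here \<open>m + 1\<close> is the number of front labels available. The three labels
  share one claw, whose star edges come from diagonals \<open>1 + k\<close> and \<open>2 + k\<close>
  after \<open>m + 1 + k\<close> reductions; all labels there are arguments, equal to 1, or covered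
  by induction.\<close>

lemma strip_subtraction_free:
  "(\<lambda>k. strip (m + 2 + k) (2 + k) Edge_L) \<in> subtraction_free (front_labels (m + 1)) \<and>
   (\<lambda>k. strip (m + 2 + k) (1 + k) Edge_R) \<in> subtraction_free (front_labels (m + 1)) \<and>
   (\<lambda>k. strip (m + 2 + k) (1 + k) Edge_B) \<in> subtraction_free (front_labels (m + 1))"
proof (induction m rule: less_induct)
  case (less m)
  let ?S = "subtraction_free (front_labels (m + 1))"
  have prev: "(\<lambda>k. strip (i + 2 + k) (2 + k) Edge_L) \<in> subtraction_free (front_labels M)"
    "(\<lambda>k. strip (i + 2 + k) (1 + k) Edge_R) \<in> subtraction_free (front_labels M)"
    "(\<lambda>k. strip (i + 2 + k) (1 + k) Edge_B) \<in> subtraction_free (front_labels M)"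
    if "i < m" "i + 1 \<le> M" for i M
    using less[OF that(1)] subtraction_free_mono front_labels_mono[OF that(2)] by blast+
  have this_diag: "(\<lambda>k. strip (m + 1 + k) (1 + k) X) \<in> ?S" for X
  proof (cases "X = Edge_L")
    case True
    then show ?thesis
      unfolding front_labels_def
      by (intro subtraction_free.base) (auto intro!: image_eqI[where x = "m + 1"])
  next
    case False
    then have X: "X = Edge_R \<or> X = Edge_B" by (cases X) auto
    show ?thesis
    proof (cases m)
      case 0
      then show ?thesis
        using X by (auto simp: strip_beyond_front subtraction_free.one)
    next
      case (Suc i)
      then show ?thesis using X prev(2,3)[of i "m + 1"] by auto
    qed
  qed
  have next_diag: "(\<lambda>k. strip (m + 1 + k) (2 + k) X) \<in> ?S" for X
  proof (cases "X = Edge_L")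
    case True
    then show ?thesis
    proof (cases m)
      case 0
      then show ?thesis
        using True by (simp add: strip_beyond_front subtraction_free.one)
    next
      case (Suc i)
      then show ?thesis using True prev(1)[of i "m + 1"] by auto
    qed
  next
    case False
    then have X: "X = Edge_R \<or> X = Edge_B" by (cases X) auto
    show ?thesis
    proof (cases "m < 2")
      case True
      then show ?thesis
        using X by (auto simp: strip_beyond_front subtraction_free.one)
    next
      case False
      then obtain i where m: "m = i + 2" by (metis le_Suc_ex not_less add.commute)
      have "(\<lambda>k. strip (i + 2 + k) (1 + k) X) \<in> subtraction_free (front_labels (i + 1))"
        using X prev(2,3)[of i "i + 1"] m by auto
      \<comment> \<open>The induction hypothesis for \<open>m - 2\<close> is read at
        \<open>k + 1\<close>. Its arguments are then labels \<open>L\<close> of diagonal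
        \<open>2 + k\<close>, which earlier instances express by those of diagonal
        \<open>1 + k\<close>.\<close>
      then have "(\<lambda>k. strip (i + 2 + (k + 1)) (1 + (k + 1)) X) \<in> ?S"
      proof (rule subtraction_free_compose)
        fix g assume "g \<in> front_labels (i + 1)"
        then obtain j' where "j' \<in> {1..i + 1}" "g = (\<lambda>k. strip (j' + k) (1 + k) Edge_L)"
          unfolding front_labels_def by blast
        then obtain j where j: "j \<le> i" "g = (\<lambda>k. strip (Suc j + k) (1 + k) Edge_L)"
          by (cases j') auto
        then show "(\<lambda>k. g (k + 1)) \<in> ?S"
          using prev(1)[of j "m + 1"] m by simp
      qed
      then show ?thesis by (simp add: m)
    qed
  qed
  have star: "(\<lambda>k. strip_star (m + 1 + k) (1 + k) v) \<in> ?S"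
    "(\<lambda>k. strip_star (m + 1 + k) (2 + k) v) \<in> ?S" for v
    unfolding strip_star_def by (intro star_subtraction_free this_diag next_diag)+
  \<comment> \<open>As \<open>2 + k\<close> is never 1, \<open>L\<close> is not in the series case;
    the three labels differ only in which star edge is the divisor.\<close>
  show ?case
    using claw_edge_subtraction_free[OF star(2)[of Bot_L] star(2)[of Top] star(1)[of Bot_R]]
      claw_edge_subtraction_free[OF star(1)[of Bot_R] star(2)[of Top] star(2)[of Bot_L]]
      claw_edge_subtraction_free[OF star(1)[of Bot_R] star(2)[of Bot_L] star(2)[of Top]]
    by (simp add: strip_Suc)
qed

theorem mainTheorem1:
  fixes e :: nat
  assumes "even e"
  shows "\<exists>G\<^sub>e \<in> ratfuns (e div 2 + 1). \<exists>G\<^sub>e\<^sub>1 \<in> ratfuns (e div 2 + 1).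
    \<forall>k::nat. \<forall>\<^sub>F n in sequentially.
      ratfun_value (e div 2 + 1) G\<^sub>e
        (\<lambda>j. tri_label n (j + k) (2 * j - 1 + 2 * k) (1 + k) Edge_L)
        (tri_label n (e div 2 + 2 + k) (e + 3 + 2 * k) (2 + k) Edge_L) \<and>
      ratfun_value (e div 2 + 1) G\<^sub>e\<^sub>1
        (\<lambda>j. tri_label n (j + k) (2 * j - 1 + 2 * k) (1 + k) Edge_L)
        (tri_label n (e div 2 + 2 + k) (e + 3 + 2 * k) (1 + k) Edge_R)"
proof -
  obtain m where e: "e = 2 * m" using assms by blast
  let ?N = "m + 1" and ?x = "\<lambda>k j. strip (j + k) (1 + k) Edge_L"
  note free = strip_subtraction_free[of m, unfolded front_labels_def]
  obtain G where G: "G \<in> ratfuns ?N" "\<And>k y. (\<forall>j\<in>{1..?N}. y j = ?x k j) \<Longrightarrow>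
      ratfun_value ?N G y (strip (m + 2 + k) (2 + k) Edge_L)"
    using subtraction_free_ratfun[of _ ?x ?N, OF free[THEN conjunct1] strip_pos] by blast
  obtain H where H: "H \<in> ratfuns ?N" "\<And>k y. (\<forall>j\<in>{1..?N}. y j = ?x k j) \<Longrightarrow>
      ratfun_value ?N H y (strip (m + 2 + k) (1 + k) Edge_R)"
    using subtraction_free_ratfun[of _ ?x ?N, OF free[THEN conjunct2, THEN conjunct1] strip_pos]
    by blast
  \<comment> \<open>The bound on \<open>n\<close> is \<open>r + 2 * s\<close> for the two target
    labels; the arguments need less.\<close>
  have vals: "ratfun_value ?N G (\<lambda>j. tri_label n (j + k) (2 * j - 1 + 2 * k) (1 + k) Edge_L)
        (tri_label n (m + 2 + k) (e + 3 + 2 * k) (2 + k) Edge_L) \<and>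
      ratfun_value ?N H (\<lambda>j. tri_label n (j + k) (2 * j - 1 + 2 * k) (1 + k) Edge_L)
        (tri_label n (m + 2 + k) (e + 3 + 2 * k) (1 + k) Edge_R)"
    if n: "n \<ge> 4 * m + 4 * k + 7" for n k
  proof -
    have "\<forall>j\<in>{1..?N}. tri_label n (j + k) (2 * j - 1 + 2 * k) (1 + k) Edge_L = ?x k j"
      using n by (auto intro!: tri_label_eq_strip(1))
    moreover have "tri_label n (m + 2 + k) (e + 3 + 2 * k) (2 + k) Edge_L =
        strip (m + 2 + k) (2 + k) Edge_L"
      using n e by (intro tri_label_eq_strip(1)) auto
    moreover have "tri_label n (m + 2 + k) (e + 3 + 2 * k) (1 + k) Edge_R =
        strip (m + 2 + k) (1 + k) Edge_R"
      using n e by (intro tri_label_eq_strip(2)) auto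
    ultimately show ?thesis using G(2) H(2) by simp
  qed
  have m: "e div 2 = m" by (simp add: e)
  show ?thesis
    unfolding m
  proof (rule bexI[OF _ G(1)], rule bexI[OF _ H(1)], rule allI)
    fix k
    show "\<forall>\<^sub>F n in sequentially.
        ratfun_value ?N G (\<lambda>j. tri_label n (j + k) (2 * j - 1 + 2 * k) (1 + k) Edge_L)
          (tri_label n (m + 2 + k) (e + 3 + 2 * k) (2 + k) Edge_L) \<and>
        ratfun_value ?N H (\<lambda>j. tri_label n (j + k) (2 * j - 1 + 2 * k) (1 + k) Edge_L)
          (tri_label n (m + 2 + k) (e + 3 + 2 * k) (1 + k) Edge_R)"
      by (rule eventually_sequentiallyI[of "4 * m + 4 * k + 7"]) (rule vals)
  qed
qed

end
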